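(* Let $p$ be a prime power and let $N$ be an integer. If $N \geq p^3$, then $$f(p,N) \geq \left\lfloor \frac{N}{p} \right\rfloor-p^2+p^3.$$
   Context: Let $k,N$ be positive integers and let $A,B$ be disjoint sets with $|A|=|B|=N$. For $S\subset A\cup B$ write $S_A=S\cap A$ and $S_B=S\cap B$. A family $\mathcal{S}$ of subsets of $A\cup B$ is called semiintersecting (with constants $k$ and $N$) if (i) $|S_A|=|S_B|=k$ for all $S\in\mathcal{S}$, and (ii) for all $S\neq T$ in $\mathcal{S}$, $S_A\cap T_A=\emptyset$ if and only if $S_B\cap T_B\neq\emptyset$. Define $f(k,N)$ to be the maximum of $|\mathcal{S}|$ over all semiintersecting families $\mathcal{S}$ with constants $k$ and $N$. *)

theory Defs
  imports "HOL-Number_Theory.Prime_Powers"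
begin

definition semiintersecting :: "nat \<Rightarrow> 'a set \<Rightarrow> 'a set \<Rightarrow> 'a set set \<Rightarrow> bool" where
  "semiintersecting k A B F \<longleftrightarrow>
     F \<subseteq> Pow (A \<union> B) \<and>
     (\<forall>S\<in>F. card (S \<inter> A) = k \<and> card (S \<inter> B) = k) \<and>
     (\<forall>S\<in>F. \<forall>T\<in>F. S \<noteq> T \<longrightarrow>
        ((S \<inter> A) \<inter> (T \<inter> A) = {} \<longleftrightarrow> (S \<inter> B) \<inter> (T \<inter> B) \<noteq> {}))"

text \<open>For finite disjoint \<open>A\<close> and \<open>B\<close> with \<open>N\<close> elements each, \<open>max_semiintersecting k A B\<close> is the
  number usually written \<open>f(k, N)\<close>; by relabelling the points it depends on \<open>A\<close> and \<open>B\<close> only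
  through \<open>N\<close>. The maximum is taken over a finite set that contains 0 (the empty family).\<close>

definition max_semiintersecting :: "nat \<Rightarrow> 'a set \<Rightarrow> 'a set \<Rightarrow> nat" where
  "max_semiintersecting k A B = Max (card ` {F. semiintersecting k A B F})"

end

theory Submission
  imports Defs "HOL-Computational_Algebra.Polynomial"
begin

text \<open>Write \<open>q\<close> for the prime power and let \<open>Q\<close> be a field with \<open>q\<close> elements. In the affine plane
  \<open>Q \<times> Q\<close> the lines \<open>y = i x + j\<close> form \<open>q\<close> parallel classes, and the lines \<open>(i, j)\<close> and \<open>(i', j')\<close> meet
  if and only if \<open>i \<noteq> i'\<close> or \<open>j = j'\<close>. Take \<open>q\<close> disjoint copies of the plane in \<open>A\<close>, indexed by
  \<open>i \<in> Q\<close>, and one copy in \<open>B\<close>. The set with index \<open>(i, j, m)\<close> consists of the line \<open>(j, m)\<close> of the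
  \<open>i\<close>-th plane in \<open>A\<close> and of the line \<open>(i, j)\<close> in \<open>B\<close>. Two different such sets meet in \<open>A\<close> iff
  \<open>i = i'\<close> and \<open>j \<noteq> j'\<close>, and they meet in \<open>B\<close> iff \<open>i \<noteq> i'\<close> or \<open>j = j'\<close>, so exactly one of the two
  happens. These \<open>q ^ 3\<close> sets occupy \<open>q ^ 2\<close> blocks of \<open>q\<close> points in \<open>A\<close>. Each of the other
  \<open>N div q - q ^ 2\<close> blocks yields one more set, whose part in \<open>B\<close> is always the same vertical line:
  it meets every line \<open>(i, j)\<close>, while the new blocks are disjoint from everything else in \<open>A\<close>. This
  is \<open>max_semiintersecting_ge_primepow\<close>.

  The field is obtained as a residue field of a cyclotomic ring. Let \<open>q = p ^ n\<close>, let \<open>z\<close> be a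
  primitive complex root of unity of order \<open>m = q - 1\<close>, and let \<open>M\<close> be a prime ideal of
  \<open>R = \<int>[z]\<close> that contains \<open>p\<close>. Every element of \<open>R\<close> is fixed by the \<open>q\<close>-th power map modulo \<open>M\<close>,
  because this map is additive modulo \<open>p\<close> and fixes \<open>z\<close> (\<open>power_q_fixes\<close>). Since \<open>x ^ q - x\<close> is the
  product of \<open>x\<close> and the factors \<open>x - z ^ k\<close>, every residue class contains \<open>0\<close> or a power of \<open>z\<close>
  (\<open>residues_exhaust\<close>), and these \<open>q\<close> numbers are pairwise incongruent (\<open>residues_distinct\<close>). Hence
  \<open>R / M\<close> has \<open>q\<close> elements, and its nonzero elements, being powers of \<open>z\<close>, are invertible.\<close>

section \<open>Integer combinations of the powers of a root of unity\<close>

text \<open>Modulo \<open>p\<close> the matrix \<open>a\<close> is diagonal with invertible entries, so its determinant is not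
  zero. Elimination of the last unknown preserves this shape, which makes determinants
  unnecessary.\<close>

lemma system_diagonal_mod_prime_trivial:
  fixes a :: "nat \<Rightarrow> nat \<Rightarrow> int" and v :: "nat \<Rightarrow> complex" and p :: nat
  assumes "prime p"
    and "\<And>i. i < m \<Longrightarrow> \<not> int p dvd a i i"
    and "\<And>i j. i < m \<Longrightarrow> j < m \<Longrightarrow> i \<noteq> j \<Longrightarrow> int p dvd a i j"
    and "\<And>i. i < m \<Longrightarrow> (\<Sum>j<m. of_int (a i j) * v j) = 0"
    and "i < m"
  shows "v i = 0"
  using assms(2-)
proof (induction m arbitrary: a i)
  case 0
  then show ?case by simp
next
  case (Suc m)
  have pr: "prime (int p)" using assms(1) by simp
  define b where "b = (\<lambda>i j. a m m * a i j - a i m * a m j)"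
  have v0: "v i = 0" if "i < m" for i
  proof (rule Suc.IH[of b])
    show "\<not> int p dvd b i i" if "i < m" for i
    proof
      assume "int p dvd b i i"
      moreover have "int p dvd a i m * a m i" using Suc.prems(2)[of i m] that by simp
      ultimately have "int p dvd a m m * a i i"
        unfolding b_def using dvd_diffD by (metis diff_add_cancel dvd_add)
      then show False using Suc.prems(1)[of m] Suc.prems(1)[of i] that pr
        by (simp add: prime_dvd_mult_iff)
    qed
    show "int p dvd b i j" if "i < m" "j < m" "i \<noteq> j" for i j
      using Suc.prems(2)[of i j] Suc.prems(2)[of i m] that unfolding b_def by simp
    show "(\<Sum>j<m. of_int (b i j) * v j) = 0" if "i < m" for i
    proof -
      have *: "(\<Sum>j<m. of_int (a k j) * v j) = - of_int (a k m) * v m" if "k < Suc m" for k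
        using Suc.prems(3)[OF that] by (simp add: add_eq_0_iff)
      have "(\<Sum>j<m. of_int (b i j) * v j) =
          of_int (a m m) * (\<Sum>j<m. of_int (a i j) * v j)
            - of_int (a i m) * (\<Sum>j<m. of_int (a m j) * v j)"
        unfolding b_def by (simp add: sum_distrib_left sum_subtractf algebra_simps)
      also have "\<dots> = 0" using *[of i] *[of m] that by simp
      finally show ?thesis .
    qed
  qed fact
  have "of_int (a m m) * v m = 0" using Suc.prems(3)[of m] v0 by simp
  moreover have "a m m \<noteq> 0" using Suc.prems(1)[of m] by auto
  ultimately have "v m = 0" by simp
  then show ?case using v0 Suc.prems(4) by (cases "i = m") auto
qed

locale root_of_unity =
  fixes m :: nat and z :: complex
  assumes m_pos: "m > 0" and z_power: "z ^ m = 1"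
begin

definition R :: "complex set" where
  "R = {x. \<exists>c :: nat \<Rightarrow> int. x = (\<Sum>k<m. of_int (c k) * z ^ k)}"

lemma R_I: "x = (\<Sum>k<m. of_int (c k) * z ^ k) \<Longrightarrow> x \<in> R"
  by (auto simp: R_def)

lemma R_power_z: "z ^ k \<in> R"
proof -
  have "z ^ k = z ^ (m * (k div m) + k mod m)" by simp
  also have "\<dots> = z ^ (k mod m)" unfolding power_add power_mult by (simp add: z_power)
  also have "\<dots> = (\<Sum>l<m. of_int (if l = k mod m then 1 else 0) * z ^ l)"
    using m_pos by (simp add: if_distrib[of of_int] if_distrib[of "\<lambda>x. x * _"] cong: if_cong)
  finally show ?thesis by (rule R_I)
qed

lemma R_add: "x \<in> R \<Longrightarrow> y \<in> R \<Longrightarrow> x + y \<in> R"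
proof -
  assume "x \<in> R" "y \<in> R"
  then obtain c d :: "nat \<Rightarrow> int" where "x = (\<Sum>k<m. of_int (c k) * z ^ k)"
    "y = (\<Sum>k<m. of_int (d k) * z ^ k)" unfolding R_def by blast
  then have "x + y = (\<Sum>k<m. of_int (c k + d k) * z ^ k)"
    by (simp add: sum.distrib algebra_simps)
  then show ?thesis by (rule R_I)
qed

lemma R_of_int_mult: "x \<in> R \<Longrightarrow> of_int n * x \<in> R"
proof -
  assume "x \<in> R"
  then obtain c :: "nat \<Rightarrow> int" where "x = (\<Sum>k<m. of_int (c k) * z ^ k)"
    unfolding R_def by blast
  then have "of_int n * x = (\<Sum>k<m. of_int (n * c k) * z ^ k)"
    by (simp add: sum_distrib_left algebra_simps)
  then show ?thesis by (rule R_I)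
qed

lemma R_of_int: "of_int n \<in> R"
  using R_of_int_mult[OF R_power_z[of 0], of n] by simp

lemma R_of_nat: "of_nat n \<in> R"
  using R_of_int[of "int n"] by simp

lemma R_0: "0 \<in> R" and R_1: "1 \<in> R"
  using R_of_int[of 0] R_of_int[of 1] by simp_all

lemma R_uminus: "x \<in> R \<Longrightarrow> - x \<in> R"
  using R_of_int_mult[of x "-1"] by simp

lemma R_diff: "x \<in> R \<Longrightarrow> y \<in> R \<Longrightarrow> x - y \<in> R"
  using R_add[OF _ R_uminus] by fastforce

lemma R_sum: "(\<And>i. i \<in> I \<Longrightarrow> f i \<in> R) \<Longrightarrow> sum f I \<in> R"
  by (induction I rule: infinite_finite_induct) (auto intro: R_0 R_add)

lemma R_mult:
  assumes "x \<in> R" "y \<in> R"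
  shows "x * y \<in> R"
proof -
  obtain c d :: "nat \<Rightarrow> int" where x: "x = (\<Sum>k<m. of_int (c k) * z ^ k)"
    and y: "y = (\<Sum>k<m. of_int (d k) * z ^ k)" using assms unfolding R_def by blast
  have "x * y = (\<Sum>k<m. \<Sum>l<m. of_int (c k) * (of_int (d l) * z ^ (k + l)))"
    unfolding x y sum_product by (simp add: power_add algebra_simps)
  also have "\<dots> \<in> R" by (intro R_sum R_of_int_mult R_power_z)
  finally show ?thesis .
qed

lemma R_power: "x \<in> R \<Longrightarrow> x ^ k \<in> R"
  by (induction k) (auto intro: R_1 R_mult)

text \<open>An inverse of \<open>p\<close> in \<open>R\<close> would write every \<open>z ^ i\<close> as \<open>p\<close> times an integer combination of
  the powers of \<open>z\<close>. This is a homogeneous system that is the identity modulo \<open>p\<close>, while its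
  solution \<open>(z ^ i)\<^sub>i\<close> is not zero.\<close>

lemma prime_not_unit:
  assumes "prime p" and "r \<in> R"
  shows "of_nat p * r \<noteq> 1"
proof
  assume eq: "of_nat p * r = 1"
  have "\<forall>i. \<exists>d :: nat \<Rightarrow> int. r * z ^ i = (\<Sum>k<m. of_int (d k) * z ^ k)"
    using R_mult[OF assms(2) R_power_z] unfolding R_def by blast
  then obtain d :: "nat \<Rightarrow> nat \<Rightarrow> int"
    where d: "\<And>i. r * z ^ i = (\<Sum>k<m. of_int (d i k) * z ^ k)" by metis
  define a where "a = (\<lambda>i j. (if i = j then 1 else 0) - int p * d i j)"
  have "z ^ 0 = 0"
  proof (rule system_diagonal_mod_prime_trivial[OF assms(1), of m a "\<lambda>i. z ^ i"])
    show "\<not> int p dvd a i i" for i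
    proof
      assume "int p dvd a i i"
      then have "int p dvd a i i + int p * d i i" by (metis dvd_add dvd_triv_left)
      then show False using assms(1) by (simp add: a_def)
    qed
    show "int p dvd a i j" if "i \<noteq> j" for i j using that by (simp add: a_def)
    show "(\<Sum>j<m. of_int (a i j) * z ^ j) = 0" if "i < m" for i
    proof -
      have "(\<Sum>j<m. of_int (a i j) * z ^ j) =
          (\<Sum>j<m. (if i = j then z ^ j else 0)) - of_nat p * (\<Sum>j<m. of_int (d i j) * z ^ j)"
        unfolding a_def sum_distrib_left sum_subtractf[symmetric]
        by (intro sum.cong) (auto simp: algebra_simps)
      also have "\<dots> = z ^ i - of_nat p * (r * z ^ i)"
        using that d by simp
      also have "\<dots> = 0" using eq by (simp flip: mult.assoc)
      finally show ?thesis .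
    qed
  qed (use m_pos in auto)
  then show False by simp
qed

definition ideal_R :: "complex set \<Rightarrow> bool" where
  "ideal_R I \<longleftrightarrow> I \<subseteq> R \<and> 0 \<in> I \<and> (\<forall>x\<in>I. \<forall>y\<in>I. x + y \<in> I) \<and> (\<forall>r\<in>R. \<forall>x\<in>I. r * x \<in> I)"

text \<open>As usual, an ideal that is maximal among the proper ideals containing \<open>p\<close> is prime; such
  ideals exist since the ideal generated by \<open>p\<close> is proper.\<close>

lemma exists_prime_ideal_over:
  assumes "prime p"
  obtains M where "ideal_R M" "of_nat p \<in> M" "1 \<notin> M"
    "\<And>x y. x \<in> R \<Longrightarrow> y \<in> R \<Longrightarrow> x * y \<in> M \<Longrightarrow> x \<in> M \<or> y \<in> M"
proof -
  define \<I> where "\<I> = {I. ideal_R I \<and> of_nat p \<in> I \<and> 1 \<notin> I}"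
  have "(\<lambda>r. of_nat p * r) ` R \<in> \<I>"
  proof -
    have "ideal_R ((\<lambda>r. of_nat p * r) ` R)"
      unfolding ideal_R_def
    proof (intro conjI ballI)
      show "(\<lambda>r. of_nat p * r) ` R \<subseteq> R" using R_mult[OF R_of_nat] by blast
      show "0 \<in> (\<lambda>r. of_nat p * r) ` R" using R_0 by force
    next
      fix x y assume "x \<in> (\<lambda>r. of_nat p * r) ` R" "y \<in> (\<lambda>r. of_nat p * r) ` R"
      then show "x + y \<in> (\<lambda>r. of_nat p * r) ` R"
        using R_add by (auto simp flip: distrib_left)
    next
      fix r x assume "r \<in> R" "x \<in> (\<lambda>r. of_nat p * r) ` R"
      then show "r * x \<in> (\<lambda>r. of_nat p * r) ` R"
        using R_mult by (auto simp: mult.left_commute)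
    qed
    moreover have "of_nat p \<in> (\<lambda>r. of_nat p * r) ` R" using R_1 by force
    moreover have "1 \<notin> (\<lambda>r. of_nat p * r) ` R" using prime_not_unit[OF assms] by force
    ultimately show ?thesis by (simp add: \<I>_def)
  qed
  then have "\<I> \<noteq> {}" by blast
  moreover have "\<Union>\<C> \<in> \<I>" if ne: "\<C> \<noteq> {}" and ch: "subset.chain \<I> \<C>" for \<C>
  proof -
    have sub: "\<And>I. I \<in> \<C> \<Longrightarrow> I \<in> \<I>" and lin: "\<And>I J. I \<in> \<C> \<Longrightarrow> J \<in> \<C> \<Longrightarrow> I \<subseteq> J \<or> J \<subseteq> I"
      using ch unfolding subset_chain_def by auto
    have "x + y \<in> \<Union>\<C>" if x: "x \<in> \<Union>\<C>" and y: "y \<in> \<Union>\<C>" for x y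
    proof -
      obtain I J where "I \<in> \<C>" "x \<in> I" "J \<in> \<C>" "y \<in> J" using x y by blast
      then obtain K where "K \<in> \<C>" "x \<in> K" "y \<in> K" using lin by blast
      then show ?thesis using sub unfolding \<I>_def ideal_R_def by blast
    qed
    moreover have "r * x \<in> \<Union>\<C>" if "r \<in> R" "x \<in> \<Union>\<C>" for r x
      using that sub unfolding \<I>_def ideal_R_def by blast
    moreover have "\<Union>\<C> \<subseteq> R" "1 \<notin> \<Union>\<C>" using sub unfolding \<I>_def ideal_R_def by blast+
    moreover have "0 \<in> \<Union>\<C>" "of_nat p \<in> \<Union>\<C>"
      using ne sub unfolding \<I>_def ideal_R_def by blast+
    ultimately show ?thesis unfolding \<I>_def ideal_R_def by blast
  qed
  ultimately obtain M where M: "M \<in> \<I>" and max: "\<And>I. I \<in> \<I> \<Longrightarrow> M \<subseteq> I \<Longrightarrow> I = M"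
    using subset_Zorn_nonempty[of \<I>] by blast
  have id: "ideal_R M" and pM: "of_nat p \<in> M" and oneM: "1 \<notin> M" using M by (auto simp: \<I>_def)
  have MR: "M \<subseteq> R" and M0: "0 \<in> M" and Madd: "\<And>x y. x \<in> M \<Longrightarrow> y \<in> M \<Longrightarrow> x + y \<in> M"
    and Mmult: "\<And>r x. r \<in> R \<Longrightarrow> x \<in> M \<Longrightarrow> r * x \<in> M"
    using id unfolding ideal_R_def by auto
  have "y \<in> M" if xR: "x \<in> R" and yR: "y \<in> R" and xy: "x * y \<in> M" and xM: "x \<notin> M" for x y
  proof -
    define I where "I = {a + r * x |a r. a \<in> M \<and> r \<in> R}"
    have "ideal_R I"
      unfolding ideal_R_def
    proof (intro conjI ballI)
      show "I \<subseteq> R" using MR xR by (auto simp: I_def intro!: R_add R_mult)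
      show "0 \<in> I" unfolding I_def using M0 R_0 by force
    next
      fix u v assume "u \<in> I" "v \<in> I"
      then obtain a r b s where "u = a + r * x" "v = b + s * x" "a \<in> M" "b \<in> M" "r \<in> R" "s \<in> R"
        by (auto simp: I_def)
      then have "u + v = (a + b) + (r + s) * x" "a + b \<in> M" "r + s \<in> R"
        by (auto simp: algebra_simps intro: Madd R_add)
      then show "u + v \<in> I" unfolding I_def by blast
    next
      fix t u assume "t \<in> R" "u \<in> I"
      then obtain a r where "u = a + r * x" "a \<in> M" "r \<in> R" by (auto simp: I_def)
      then have "t * u = t * a + (t * r) * x" by (simp add: algebra_simps)
      moreover have "t * a \<in> M" "t * r \<in> R"
        using \<open>t \<in> R\<close> \<open>a \<in> M\<close> \<open>r \<in> R\<close> by (auto intro: Mmult R_mult)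
      ultimately show "t * u \<in> I" unfolding I_def by blast
    qed
    moreover have sub: "M \<subseteq> I" unfolding I_def using R_0 by force
    moreover have "x \<in> I" unfolding I_def using M0 R_1 by force
    ultimately have "I \<notin> \<I>" using max[of I] xM by blast
    then have "1 \<in> I" using \<open>ideal_R I\<close> sub pM unfolding \<I>_def by blast
    then obtain a r where ar: "1 = a + r * x" "a \<in> M" "r \<in> R" by (auto simp: I_def)
    have "y = (a + r * x) * y" using ar(1) by simp
    also have "\<dots> = y * a + r * (x * y)" by (simp add: algebra_simps)
    also have "\<dots> \<in> M" using ar yR xy by (blast intro: Madd Mmult)
    finally show ?thesis .
  qed
  then show ?thesis using that[OF id pM oneM] by blast
qed

end

section \<open>The field of prime power order\<close>

text \<open>The residue field \<open>R / M\<close> has order \<open>p ^ n\<close>. It is never formed as a quotient: equality of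
  classes is expressed by membership of the difference in \<open>M\<close>.\<close>

locale residue_field = root_of_unity +
  fixes p n :: nat and M :: "complex set"
  assumes prime_p: "prime p" and n_pos: "n > 0" and m_eq: "m = p ^ n - 1"
    and primitive: "\<And>d. 0 < d \<Longrightarrow> d < m \<Longrightarrow> z ^ d \<noteq> 1"
    and ideal_M: "ideal_R M" and p_in_M: "of_nat p \<in> M" and one_notin_M: "1 \<notin> M"
    and prime_M: "\<And>x y. x \<in> R \<Longrightarrow> y \<in> R \<Longrightarrow> x * y \<in> M \<Longrightarrow> x \<in> M \<or> y \<in> M"
begin

lemma M_R: "x \<in> M \<Longrightarrow> x \<in> R"
  and M_0: "0 \<in> M"
  and M_add: "x \<in> M \<Longrightarrow> y \<in> M \<Longrightarrow> x + y \<in> M"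
  and M_mult: "r \<in> R \<Longrightarrow> x \<in> M \<Longrightarrow> r * x \<in> M"
  using ideal_M unfolding ideal_R_def by auto

lemma M_uminus: "x \<in> M \<Longrightarrow> - x \<in> M"
  using M_mult[of "-1" x] R_uminus[OF R_1] by simp

lemma M_diff: "x \<in> M \<Longrightarrow> y \<in> M \<Longrightarrow> x - y \<in> M"
  using M_add[OF _ M_uminus] by fastforce

lemma M_minus_commute: "x - y \<in> M \<Longrightarrow> y - x \<in> M"
  using M_uminus[of "x - y"] by simp

lemma M_sum: "(\<And>i. i \<in> I \<Longrightarrow> f i \<in> M) \<Longrightarrow> sum f I \<in> M"
  by (induction I rule: infinite_finite_induct) (auto intro: M_0 M_add)

lemma M_power_diff:
  assumes "x \<in> R" "y \<in> R" "x - y \<in> M"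
  shows "x ^ k - y ^ k \<in> M"
proof (induction k)
  case (Suc k)
  have "x ^ Suc k - y ^ Suc k = x * (x ^ k - y ^ k) + y ^ k * (x - y)"
    by (simp add: algebra_simps)
  also have "\<dots> \<in> M" using assms Suc by (intro M_add M_mult R_power)
  finally show ?case .
qed (simp add: M_0)

lemma M_prod:
  assumes "finite I" "\<And>i. i \<in> I \<Longrightarrow> f i \<in> R" "prod f I \<in> M"
  shows "\<exists>i\<in>I. f i \<in> M"
  using assms
proof (induction I rule: finite_induct)
  case (insert i I)
  have "prod f I \<in> R" using insert.prems(1)
    by (induction I rule: infinite_finite_induct) (auto intro: R_1 R_mult)
  then show ?case using insert prime_M[of "f i" "prod f I"] by auto
qed (use one_notin_M in simp)

text \<open>The binomial coefficients strictly between the ends of the \<open>p\<close>-th row are divisible by \<open>p\<close>.\<close>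

lemma frobenius_add:
  assumes "x \<in> R" "y \<in> R"
  shows "(x + y) ^ p - (x ^ p + y ^ p) \<in> M"
proof -
  have p0: "p > 0" using prime_p by (simp add: prime_gt_0_nat)
  define t where "t = (\<lambda>k. of_nat (p choose k) * x ^ k * y ^ (p - k))"
  have "{..p} = insert 0 (insert p {0<..<p})" using p0 by auto
  then have "(x + y) ^ p = t 0 + (t p + sum t {0<..<p})"
    unfolding binomial_ring t_def using p0 by simp
  then have "(x + y) ^ p - (x ^ p + y ^ p) = sum t {0<..<p}" by (simp add: t_def)
  also have "\<dots> \<in> M"
  proof (rule M_sum)
    fix k assume "k \<in> {0<..<p}"
    then have "p dvd (p choose k)" using prime_p by (intro dvd_choose_prime) auto
    then obtain c where "p choose k = p * c" by blast
    then have "t k = (of_nat c * x ^ k * y ^ (p - k)) * of_nat p" by (simp add: t_def)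
    then show "t k \<in> M" using assms p_in_M by (auto intro!: M_mult R_mult R_power R_of_nat)
  qed
  finally show ?thesis .
qed

lemma frobenius_power_add:
  assumes "x \<in> R" "y \<in> R"
  shows "(x + y) ^ (p ^ k) - (x ^ (p ^ k) + y ^ (p ^ k)) \<in> M"
proof (induction k)
  case (Suc k)
  let ?u = "x ^ (p ^ k)" and ?v = "y ^ (p ^ k)"
  have "((x + y) ^ (p ^ k)) ^ p - (?u + ?v) ^ p \<in> M"
    using Suc assms by (intro M_power_diff R_add R_power)
  moreover have "(?u + ?v) ^ p - (?u ^ p + ?v ^ p) \<in> M"
    using assms by (intro frobenius_add R_power)
  ultimately have "(((x + y) ^ (p ^ k)) ^ p - (?u + ?v) ^ p) + ((?u + ?v) ^ p - (?u ^ p + ?v ^ p)) \<in> M"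
    by (rule M_add)
  also have "(((x + y) ^ (p ^ k)) ^ p - (?u + ?v) ^ p) + ((?u + ?v) ^ p - (?u ^ p + ?v ^ p)) =
      (x + y) ^ (p ^ Suc k) - (x ^ (p ^ Suc k) + y ^ (p ^ Suc k))"
    by (simp add: mult.commute[of p] power_mult)
  finally show ?case .
qed (simp add: M_0)

text \<open>The elements fixed by the \<open>p ^ n\<close>-power map modulo \<open>M\<close> are closed under addition by the
  Frobenius identity, and under multiplication. They contain \<open>z\<close>, because \<open>z ^ m = 1\<close>, and the
  integers, because these are congruent to sums of ones; hence they are all of \<open>R\<close>.\<close>

lemma power_q_fixes:
  assumes "x \<in> R"
  shows "x ^ (p ^ n) - x \<in> M"
proof -
  define q where "q = p ^ n"
  define T where "T = {x\<in>R. x ^ q - x \<in> M}"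
  have q0: "q > 0" using prime_p by (simp add: q_def prime_gt_0_nat)
  have T_add: "x + y \<in> T" if "x \<in> T" "y \<in> T" for x y
  proof -
    have "(x + y) ^ q - (x + y) =
        ((x + y) ^ q - (x ^ q + y ^ q)) + ((x ^ q - x) + (y ^ q - y))" by simp
    also have "\<dots> \<in> M"
      using that frobenius_power_add[of x y n] unfolding T_def q_def by (intro M_add) auto
    finally show ?thesis using that by (auto simp: T_def intro: R_add)
  qed
  have T_mult: "x * y \<in> T" if "x \<in> T" "y \<in> T" for x y
  proof -
    have "(x * y) ^ q - x * y = x ^ q * (y ^ q - y) + y * (x ^ q - x)"
      by (simp add: algebra_simps power_mult_distrib)
    also have "\<dots> \<in> M"
      using that unfolding T_def by (intro M_add M_mult R_power) auto
    finally show ?thesis using that by (auto simp: T_def intro: R_mult)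
  qed
  have T_0: "0 \<in> T" using q0 by (simp add: T_def R_0 M_0 zero_power)
  have T_1: "1 \<in> T" by (simp add: T_def R_1 M_0)
  have T_nat: "of_nat k \<in> T" for k
    by (induction k) (auto intro: T_0 T_1 T_add)
  have M_T: "x \<in> T" if "x \<in> M" for x
  proof -
    have "x ^ (q - 1) * x \<in> M" by (rule M_mult[OF R_power[OF M_R[OF that]] that])
    then have "x ^ q \<in> M" using power_minus_mult[OF q0, of x] by simp
    then have "x ^ q - x \<in> M" using that by (rule M_diff)
    then show ?thesis using that by (simp add: T_def M_R)
  qed
  have T_int: "of_int k \<in> T" for k
  proof -
    have "k = int (nat (k mod int p)) + (k div int p) * int p"
      using prime_p by (simp add: prime_gt_0_nat)
    then have "(of_int k :: complex) = of_int (int (nat (k mod int p)) + (k div int p) * int p)"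
      by (rule arg_cong)
    then have "(of_int k :: complex) =
        of_nat (nat (k mod int p)) + of_int (k div int p) * of_nat p"
      by (simp only: of_int_add of_int_mult of_int_of_nat_eq)
    then show ?thesis using T_add[OF T_nat M_T[OF M_mult[OF R_of_int p_in_M]]] by simp
  qed
  have "z ^ q = z" using power_minus_mult[OF q0, of z] z_power by (simp add: m_eq q_def)
  then have "z \<in> T" using R_power_z[of 1] by (simp add: T_def M_0)
  then have T_z: "z ^ k \<in> T" for k by (induction k) (auto intro: T_1 T_mult)
  have T_sum: "sum f I \<in> T" if "\<And>i. i \<in> I \<Longrightarrow> f i \<in> T" for f and I :: "nat set"
    using that by (induction I rule: infinite_finite_induct) (auto intro: T_0 T_add)
  obtain c :: "nat \<Rightarrow> int" where "x = (\<Sum>k<m. of_int (c k) * z ^ k)"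
    using assms unfolding R_def by blast
  then have "x \<in> T" by (simp only: T_sum T_mult T_int T_z)
  then show ?thesis by (simp add: T_def q_def)
qed

lemma z_nonzero: "z \<noteq> 0"
  using z_power m_pos by (metis power_eq_0_iff zero_neq_one)

lemma z_power_inj: "inj_on (\<lambda>k. z ^ k) {..<m}"
proof (rule linorder_inj_onI)
  fix i j assume "i < j" "j \<in> {..<m}"
  moreover have "z ^ j = z ^ i * z ^ (j - i)" using \<open>i < j\<close> by (simp flip: power_add)
  ultimately show "z ^ i \<noteq> z ^ j" using primitive[of "j - i"] z_nonzero by auto
qed auto

text \<open>Both sides are monic polynomials of degree \<open>m\<close> in \<open>x\<close> that vanish at the \<open>m\<close> powers of \<open>z\<close>.\<close>

lemma power_m_minus_one_eq_prod: "x ^ m - 1 = (\<Prod>k<m. x - z ^ k)"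
proof -
  define P where "P = (monom 1 m - 1 :: complex poly)"
  define Q where "Q = (\<Prod>k<m. [:- (z ^ k), 1:])"
  have degQ: "degree Q = m" unfolding Q_def by (simp add: degree_prod_eq_sum_degree)
  have lcQ: "lead_coeff Q = 1" unfolding Q_def lead_coeff_prod by simp
  have "P = Q"
  proof (rule poly_eqI_degree_lead_coeff)
    show "coeff P m = coeff Q m" using lcQ degQ m_pos by (simp add: P_def)
    show "m \<le> card ((\<lambda>k. z ^ k) ` {..<m})" using card_image[OF z_power_inj] by simp
    show "degree P \<le> m" unfolding P_def by (intro degree_diff_le degree_monom_le) simp
    show "degree Q \<le> m" using degQ by simp
    show "poly P x = poly Q x" if x: "x \<in> (\<lambda>k. z ^ k) ` {..<m}" for x
    proof -
      obtain k where k: "x = z ^ k" "k < m" using x by blast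
      have "(z ^ k) ^ m = (z ^ m) ^ k" by (metis power_mult mult.commute)
      then have "poly P x = 0" by (simp add: P_def k poly_monom z_power)
      also have "0 = poly Q x" unfolding Q_def poly_prod using k by (auto intro!: prod_zero)
      finally show ?thesis .
    qed
  qed
  then have "poly P x = poly Q x" by simp
  then show ?thesis by (simp add: P_def Q_def poly_prod poly_monom)
qed

definition residues :: "complex set" where
  "residues = insert 0 ((\<lambda>k. z ^ k) ` {..<m})"

lemma residues_R: "x \<in> residues \<Longrightarrow> x \<in> R"
  by (auto simp: residues_def intro: R_0 R_power_z)

lemma finite_residues: "finite residues"
  by (simp add: residues_def)

lemma card_residues: "card residues = p ^ n"
proof -
  have "0 \<notin> (\<lambda>k. z ^ k) ` {..<m}" using z_nonzero by auto
  then have "card residues = Suc m"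
    unfolding residues_def using card_image[OF z_power_inj] by simp
  then show ?thesis using m_eq prime_p by (simp add: prime_gt_0_nat)
qed

text \<open>The prime ideal \<open>M\<close> contains \<open>x ^ (p ^ n) - x\<close>, which is the product of the factors \<open>x - r\<close> with
  \<open>r\<close> in \<^const>\<open>residues\<close>.\<close>

lemma residues_exhaust:
  assumes "x \<in> R"
  shows "\<exists>r\<in>residues. x - r \<in> M"
proof (rule ccontr)
  assume neg: "\<not> (\<exists>r\<in>residues. x - r \<in> M)"
  have "x ^ (p ^ n) - x = x * (x ^ m - 1)"
    using power_minus_mult[of "p ^ n" x] prime_p
    by (simp add: m_eq prime_gt_0_nat algebra_simps)
  then have "x * (x ^ m - 1) \<in> M" using power_q_fixes[OF assms] by simp
  moreover have "x \<notin> M" using neg by (auto simp: residues_def)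
  ultimately have "x ^ m - 1 \<in> M" using prime_M assms by (blast intro: R_diff R_power R_1)
  then have "\<exists>k\<in>{..<m}. x - z ^ k \<in> M"
    unfolding power_m_minus_one_eq_prod
    using assms by (intro M_prod) (auto intro: R_diff R_power_z)
  then show False using neg by (auto simp: residues_def)
qed

lemma z_power_notin_M: "k \<le> m \<Longrightarrow> z ^ k \<notin> M"
proof
  assume "k \<le> m" "z ^ k \<in> M"
  then have "z ^ (m - k) * z ^ k \<in> M" by (intro M_mult R_power_z)
  then show False using \<open>k \<le> m\<close> z_power one_notin_M by (simp flip: power_add)
qed

text \<open>If \<open>z ^ d\<close> were congruent to 1, then the sum of the \<open>m\<close> powers of \<open>z ^ d\<close>, which vanishes, would
  be congruent to \<open>m\<close>, that is, to \<open>-1\<close>.\<close>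

lemma primitive_mod:
  assumes "0 < d" "d < m"
  shows "z ^ d - 1 \<notin> M"
proof
  assume *: "z ^ d - 1 \<in> M"
  have "(\<Sum>k<m. 1 - (z ^ d) ^ k) \<in> M"
    using M_minus_commute[OF M_power_diff[OF R_power_z R_1 *]] by (intro M_sum) simp
  moreover have "(\<Sum>k<m. (z ^ d) ^ k) = 0"
  proof -
    have "(z ^ d) ^ m = (z ^ m) ^ d" by (metis power_mult mult.commute)
    then show ?thesis using primitive[OF assms] by (simp add: geometric_sum z_power)
  qed
  ultimately have "of_nat m \<in> M" by (simp add: sum_subtractf)
  moreover have "of_nat (p ^ n) \<in> M"
    using M_mult[OF R_power[OF R_of_nat] p_in_M, of p "n - 1"]
      power_minus_mult[OF n_pos, of "of_nat p :: complex"] by simp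
  ultimately have "of_nat (p ^ n) - of_nat m \<in> M" by (intro M_diff)
  moreover have "p ^ n = Suc m" using m_eq prime_p by (simp add: prime_gt_0_nat)
  ultimately show False using one_notin_M by simp
qed

lemma residues_distinct:
  assumes "r \<in> residues" "s \<in> residues" "r - s \<in> M"
  shows "r = s"
proof -
  have zero: "z ^ k - 0 \<notin> M" if "k < m" for k using z_power_notin_M[of k] that by simp
  have pow: "z ^ j - z ^ i \<notin> M" if "i < j" "j < m" for i j
  proof
    assume "z ^ j - z ^ i \<in> M"
    moreover have "z ^ j = z ^ i * z ^ (j - i)" using \<open>i < j\<close> by (simp flip: power_add)
    ultimately have "z ^ i * (z ^ (j - i) - 1) \<in> M" by (simp add: algebra_simps)
    then show False
      using prime_M[of "z ^ i" "z ^ (j - i) - 1"] z_power_notin_M[of i] primitive_mod[of "j - i"] that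
      by (auto intro: R_power_z R_diff R_1)
  qed
  have "s - r \<in> M" using M_minus_commute assms(3) .
  then show ?thesis using assms zero pow unfolding residues_def
    by (auto dest: M_minus_commute) (metis linorder_neqE_nat)
qed

text \<open>Every residue outside \<open>M\<close> is a power of \<open>z\<close>, whose inverse is a power of \<open>z\<close> again.\<close>

lemma solve_linear_mod:
  assumes "a \<in> R" "b \<in> R" "a \<notin> M"
  shows "\<exists>x\<in>residues. a * x + b \<in> M"
proof -
  obtain r where r: "r \<in> residues" "a - r \<in> M" using residues_exhaust[OF assms(1)] by blast
  then have "r \<noteq> 0" using assms(3) by auto
  then obtain k where k: "r = z ^ k" "k < m" using r(1) by (auto simp: residues_def)
  define y where "y = - (z ^ (m - k) * b)"
  have yR: "y \<in> R" unfolding y_def using assms by (intro R_uminus R_mult R_power_z)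
  then obtain x where x: "x \<in> residues" "y - x \<in> M" using residues_exhaust by blast
  have "r * z ^ (m - k) = 1" using k z_power by (simp flip: power_add)
  then have "r * y + b = 0" unfolding y_def by (simp flip: mult.assoc)
  then have "a * x + b = y * (a - r) - a * (y - x)" by (simp add: algebra_simps)
  also have "\<dots> \<in> M" by (rule M_diff[OF M_mult[OF yR r(2)] M_mult[OF assms(1) x(2)]])
  finally show ?thesis using x by blast
qed

text \<open>The function \<open>f i j\<close> is \<open>x \<mapsto> i x + j\<close> in the residue field.\<close>

lemma exists_lines:
  obtains f where "\<And>i j x. i \<in> residues \<Longrightarrow> j \<in> residues \<Longrightarrow> x \<in> residues \<Longrightarrow> f i j x \<in> residues"
    and "\<And>i j i' j'. i \<in> residues \<Longrightarrow> j \<in> residues \<Longrightarrow> i' \<in> residues \<Longrightarrow> j' \<in> residues \<Longrightarrow>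
      (\<exists>x\<in>residues. f i j x = f i' j' x) \<longleftrightarrow> i \<noteq> i' \<or> j = j'"
proof -
  obtain red where red: "\<And>x. x \<in> R \<Longrightarrow> red x \<in> residues" "\<And>x. x \<in> R \<Longrightarrow> x - red x \<in> M"
    using residues_exhaust by metis
  have red_eq: "red x = red y \<longleftrightarrow> x - y \<in> M" if "x \<in> R" "y \<in> R" for x y
  proof
    assume "red x = red y"
    then have "x - y = (x - red x) - (y - red y)" by simp
    then show "x - y \<in> M" using M_diff red that by metis
  next
    assume "x - y \<in> M"
    then have "(x - y) - (x - red x) + (y - red y) \<in> M"
      using M_add[OF M_diff red(2)[OF that(2)]] red(2)[OF that(1)] by blast
    then have "red x - red y \<in> M" by simp
    then show "red x = red y" using residues_distinct red that by blast
  qed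
  show ?thesis
  proof (rule that[of "\<lambda>i j x. red (i * x + j)"])
    fix i j i' j'
    assume ij: "i \<in> residues" "j \<in> residues" "i' \<in> residues" "j' \<in> residues"
    note ijR = ij[THEN residues_R]
    have iff: "red (i * x + j) = red (i' * x + j') \<longleftrightarrow> (i - i') * x + (j - j') \<in> M"
      if "x \<in> residues" for x
    proof -
      have "(i * x + j) - (i' * x + j') = (i - i') * x + (j - j')" by (simp add: algebra_simps)
      moreover have "i * x + j \<in> R" "i' * x + j' \<in> R"
        using ijR residues_R[OF that] by (auto intro: R_add R_mult)
      ultimately show ?thesis by (simp only: red_eq)
    qed
    show "(\<exists>x\<in>residues. red (i * x + j) = red (i' * x + j')) \<longleftrightarrow> i \<noteq> i' \<or> j = j'"
    proof (cases "i = i'")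
      case True
      have "0 \<in> residues" by (simp add: residues_def)
      then show ?thesis using True iff residues_distinct[OF ij(2,4)] by auto
    next
      case False
      then have "i - i' \<notin> M" using residues_distinct ij by blast
      then have "\<exists>x\<in>residues. (i - i') * x + (j - j') \<in> M"
        using solve_linear_mod[of "i - i'" "j - j'"] ijR by (simp add: R_diff)
      then show ?thesis using False iff by blast
    qed
  qed (intro red(1) R_add R_mult residues_R)
qed

end

lemma exists_primitive_root_of_unity:
  assumes "m > 0"
  obtains z :: complex where "z ^ m = 1" "\<And>d. 0 < d \<Longrightarrow> d < m \<Longrightarrow> z ^ d \<noteq> 1"
proof
  let ?z = "cis (2 * pi / real m)"
  show "?z ^ m = 1" using assms by (simp add: DeMoivre)
  have inj: "inj_on (\<lambda>k. cis (2 * pi * real k / real m)) {..<m}"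
    using bij_betw_roots_unity[OF assms] by (simp add: bij_betw_def)
  show "?z ^ d \<noteq> 1" if "0 < d" "d < m" for d
    using inj_onD[OF inj, of d 0] that by (auto simp: DeMoivre mult.commute)
qed

text \<open>The graphs of the functions \<open>f i j\<close> are the non-vertical lines of an affine plane, \<open>i\<close> being the
  slope.\<close>

lemma affine_plane_of_primepow_order:
  fixes q :: nat
  assumes "primepow q"
  obtains Q :: "complex set" and f :: "complex \<Rightarrow> complex \<Rightarrow> complex \<Rightarrow> complex"
  where "finite Q" "card Q = q"
    and "\<And>i j x. i \<in> Q \<Longrightarrow> j \<in> Q \<Longrightarrow> x \<in> Q \<Longrightarrow> f i j x \<in> Q"
    and "\<And>i j i' j'. i \<in> Q \<Longrightarrow> j \<in> Q \<Longrightarrow> i' \<in> Q \<Longrightarrow> j' \<in> Q \<Longrightarrow>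
      (\<exists>x\<in>Q. f i j x = f i' j' x) \<longleftrightarrow> i \<noteq> i' \<or> j = j'"
proof -
  obtain p n where pn: "prime p" "n > 0" "q = p ^ n"
    using assms unfolding primepow_def by blast
  have "q > 1" using pn by (metis one_less_power prime_gt_1_nat)
  then have m: "p ^ n - 1 > 0" using pn by simp
  obtain z :: complex where z: "z ^ (p ^ n - 1) = 1"
    "\<And>d. 0 < d \<Longrightarrow> d < p ^ n - 1 \<Longrightarrow> z ^ d \<noteq> 1"
    using exists_primitive_root_of_unity[OF m] by blast
  interpret root_of_unity "p ^ n - 1" z by standard (use m z in auto)
  obtain M where M: "ideal_R M" "of_nat p \<in> M" "1 \<notin> M"
    "\<And>x y. x \<in> R \<Longrightarrow> y \<in> R \<Longrightarrow> x * y \<in> M \<Longrightarrow> x \<in> M \<or> y \<in> M"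
    using exists_prime_ideal_over[OF pn(1)] by blast
  interpret residue_field "p ^ n - 1" z p n M
    by standard (use pn z M in auto)
  obtain f where f: "\<And>i j x. i \<in> residues \<Longrightarrow> j \<in> residues \<Longrightarrow> x \<in> residues \<Longrightarrow> f i j x \<in> residues"
    "\<And>i j i' j'. i \<in> residues \<Longrightarrow> j \<in> residues \<Longrightarrow> i' \<in> residues \<Longrightarrow> j' \<in> residues \<Longrightarrow>
      (\<exists>x\<in>residues. f i j x = f i' j' x) \<longleftrightarrow> i \<noteq> i' \<or> j = j'"
    using exists_lines by blast
  show ?thesis
    by (rule that[OF finite_residues _ f]) (use card_residues pn in simp_all)
qed

section \<open>The family of sets\<close>

lemma card_le_max_semiintersecting:
  assumes "finite A" "finite B" "semiintersecting k A B F"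
  shows "card F \<le> max_semiintersecting k A B"
proof -
  have "{F. semiintersecting k A B F} \<subseteq> Pow (Pow (A \<union> B))"
    by (auto simp: semiintersecting_def)
  then have "finite {F. semiintersecting k A B F}"
    using assms by (meson finite_Pow_iff finite_Un finite_subset)
  then show ?thesis unfolding max_semiintersecting_def using assms by (intro Max_ge) auto
qed

text \<open>The two parts of the members may be prescribed by sets \<open>U i\<close> and \<open>V i\<close> over any finite ground
  sets that embed into \<open>A\<close> and \<open>B\<close>. Different indices give different members, since equal ones
  would meet in both parts.\<close>

lemma max_semiintersecting_ge_index:
  fixes U :: "'i \<Rightarrow> 'x set" and V :: "'i \<Rightarrow> 'y set"
  assumes fin: "finite A" "finite B" and disj: "A \<inter> B = {}"
    and X: "finite X" "card X \<le> card A" and Y: "finite Y" "card Y \<le> card B"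
    and U: "\<And>i. i \<in> I \<Longrightarrow> U i \<subseteq> X \<and> card (U i) = k"
    and V: "\<And>i. i \<in> I \<Longrightarrow> V i \<subseteq> Y \<and> card (V i) = k"
    and "k > 0"
    and UV: "\<And>i j. i \<in> I \<Longrightarrow> j \<in> I \<Longrightarrow> i \<noteq> j \<Longrightarrow> U i \<inter> U j = {} \<longleftrightarrow> V i \<inter> V j \<noteq> {}"
  shows "card I \<le> max_semiintersecting k A B"
proof -
  obtain a where a: "a ` X \<subseteq> A" "inj_on a X" using card_le_inj[OF X(1) fin(1) X(2)] by blast
  obtain b where b: "b ` Y \<subseteq> B" "inj_on b Y" using card_le_inj[OF Y(1) fin(2) Y(2)] by blast
  define S where "S = (\<lambda>i. a ` U i \<union> b ` V i)"
  have SA: "S i \<inter> A = a ` U i" and SB: "S i \<inter> B = b ` V i" if "i \<in> I" for i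
    using U[OF that] V[OF that] a(1) b(1) disj unfolding S_def by blast+
  have cA: "card (S i \<inter> A) = k" and cB: "card (S i \<inter> B) = k" if "i \<in> I" for i
    using U[OF that] V[OF that] a(2) b(2) SA[OF that] SB[OF that]
    by (auto simp: card_image inj_on_subset)
  have meetA: "S i \<inter> A \<inter> (S j \<inter> A) = {} \<longleftrightarrow> U i \<inter> U j = {}" if "i \<in> I" "j \<in> I" for i j
    unfolding SA[OF that(1)] SA[OF that(2)]
    using inj_on_image_Int[OF a(2)] U[OF that(1)] U[OF that(2)] by (metis image_is_empty)
  have meetB: "S i \<inter> B \<inter> (S j \<inter> B) = {} \<longleftrightarrow> V i \<inter> V j = {}" if "i \<in> I" "j \<in> I" for i j
    unfolding SB[OF that(1)] SB[OF that(2)]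
    using inj_on_image_Int[OF b(2)] V[OF that(1)] V[OF that(2)] by (metis image_is_empty)
  have semi: "S i \<inter> A \<inter> (S j \<inter> A) = {} \<longleftrightarrow> S i \<inter> B \<inter> (S j \<inter> B) \<noteq> {}"
    if "i \<in> I" "j \<in> I" "i \<noteq> j" for i j
    using meetA meetB UV that by simp
  have "inj_on S I"
  proof (rule inj_onI, rule ccontr)
    fix i j assume ij: "i \<in> I" "j \<in> I" "S i = S j" "i \<noteq> j"
    then have "S i \<inter> A = {} \<longleftrightarrow> S i \<inter> B \<noteq> {}" using semi[of i j] by simp
    moreover have "S i \<inter> A \<noteq> {}" "S i \<inter> B \<noteq> {}"
      using cA[OF ij(1)] cB[OF ij(1)] \<open>k > 0\<close> by (metis card.empty less_numeral_extra(3))+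
    ultimately show False by simp
  qed
  moreover have "semiintersecting k A B (S ` I)"
    unfolding semiintersecting_def
  proof (intro conjI)
    show "S ` I \<subseteq> Pow (A \<union> B)" using U V a(1) b(1) unfolding S_def by blast
    show "\<forall>S\<in>S ` I. card (S \<inter> A) = k \<and> card (S \<inter> B) = k" using cA cB by simp
    show "\<forall>T\<in>S ` I. \<forall>T'\<in>S ` I. T \<noteq> T' \<longrightarrow> (T \<inter> A \<inter> (T' \<inter> A) = {} \<longleftrightarrow> T \<inter> B \<inter> (T' \<inter> B) \<noteq> {})"
      using semi by blast
  qed
  ultimately show ?thesis using card_le_max_semiintersecting[OF fin] by (metis card_image)
qed

text \<open>Here \<open>D\<close> counts blocks of \<open>q\<close> points in \<open>A\<close>: the \<open>q\<close> affine planes use \<open>q ^ 2\<close> of them, and each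
  of the others gives one extra member.\<close>

lemma max_semiintersecting_ge_primepow:
  fixes q :: nat
  assumes fin: "finite A" "finite B" and disj: "A \<inter> B = {}"
    and "primepow q"
    and cA: "D * q \<le> card A" and D: "q ^ 2 \<le> D" and cB: "q ^ 2 \<le> card B"
  shows "q ^ 3 + (D - q ^ 2) \<le> max_semiintersecting q A B"
proof -
  obtain Q :: "complex set" and f where Q: "finite Q" "card Q = q"
    and fQ: "\<And>i j x. i \<in> Q \<Longrightarrow> j \<in> Q \<Longrightarrow> x \<in> Q \<Longrightarrow> f i j x \<in> Q"
    and f: "\<And>i j i' j'. i \<in> Q \<Longrightarrow> j \<in> Q \<Longrightarrow> i' \<in> Q \<Longrightarrow> j' \<in> Q \<Longrightarrow>
      (\<exists>x\<in>Q. f i j x = f i' j' x) \<longleftrightarrow> i \<noteq> i' \<or> j = j'"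
    using affine_plane_of_primepow_order[OF \<open>primepow q\<close>] by blast
  have q0: "q > 0" using \<open>primepow q\<close> by (simp add: primepow_gt_0_nat)
  then obtain o' where o': "o' \<in> Q" using Q by fastforce
  \<comment> \<open>The column \<open>x\<close> of the \<open>i\<close>-th plane in \<open>A\<close> is the block \<open>Inl (i, x)\<close>, and \<open>Inr t\<close> is an extra
    block; all extra members contain the column \<open>o'\<close> of the plane in \<open>B\<close>.\<close>
  define E where "E = {q ^ 2..<D}"
  define X where "X = ((Q \<times> Q) <+> E) \<times> Q"
  define Y where "Y = Q \<times> Q"
  define I where "I = (Q \<times> Q \<times> Q) <+> E"
  define U where "U = (\<lambda>s :: complex \<times> complex \<times> complex + nat.
    case s of Inl (i, j, m) \<Rightarrow> (\<lambda>x. (Inl (i, x), f j m x)) ` Q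
    | Inr t \<Rightarrow> {Inr t} \<times> Q)"
  define V where "V = (\<lambda>s :: complex \<times> complex \<times> complex + nat.
    case s of Inl (i, j, m) \<Rightarrow> (\<lambda>x. (x, f i j x)) ` Q | Inr t \<Rightarrow> {o'} \<times> Q)"
  have cE: "card E = D - q ^ 2" and fE: "finite E" by (simp_all add: E_def)
  have "card I = q ^ 3 + (D - q ^ 2)"
    unfolding I_def using Q fE cE
    by (simp add: card_Plus card_cartesian_product power3_eq_cube)
  moreover have "card I \<le> max_semiintersecting q A B"
  proof (rule max_semiintersecting_ge_index[OF fin disj])
    show "finite X" "finite Y" using Q fE by (auto simp: X_def Y_def)
    have "card X = D * q" unfolding X_def using Q fE cE D
      by (simp add: card_Plus card_cartesian_product power2_eq_square)
    then show "card X \<le> card A" using cA by simp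
    show "card Y \<le> card B" using cB Q
      by (simp add: Y_def card_cartesian_product power2_eq_square)
    show "q > 0" by fact
    fix s assume s: "s \<in> I"
    show "U s \<subseteq> X \<and> card (U s) = q"
    proof (cases s)
      case (Inl a)
      then obtain i j m where a: "s = Inl (i, j, m)" by (cases a) auto
      have "inj_on (\<lambda>x. (Inl (i, x) :: complex \<times> complex + nat, f j m x)) Q"
        by (auto simp: inj_on_def)
      then show ?thesis using s a Q fQ
        by (auto simp: U_def X_def I_def card_image)
    qed (use s Q in \<open>auto simp: U_def X_def I_def card_cartesian_product\<close>)
    show "V s \<subseteq> Y \<and> card (V s) = q"
    proof (cases s)
      case (Inl a)
      then obtain i j m where a: "s = Inl (i, j, m)" by (cases a) auto
      have "inj_on (\<lambda>x. (x, f i j x)) Q" by (auto simp: inj_on_def)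
      then show ?thesis using s a Q fQ
        by (auto simp: V_def Y_def I_def card_image)
    qed (use s Q o' in \<open>auto simp: V_def Y_def card_cartesian_product\<close>)
    fix s' assume s': "s' \<in> I" and ne: "s \<noteq> s'"
    show "U s \<inter> U s' = {} \<longleftrightarrow> V s \<inter> V s' \<noteq> {}"
    proof -
      have VE: "V (Inl (i, j, m)) \<inter> ({o'} \<times> Q) \<noteq> {}" if "i \<in> Q" "j \<in> Q" for i j m
        using that o' fQ unfolding V_def by auto
      consider (LL) i j m i' j' m' where "s = Inl (i, j, m)" "s' = Inl (i', j', m')"
        | (LR) i j m t where "s = Inl (i, j, m)" "s' = Inr t"
        | (RL) i j m t where "s = Inr t" "s' = Inl (i, j, m)"
        | (RR) t t' where "s = Inr t" "s' = Inr t'"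
        by (metis sumE prod_cases3)
      then show ?thesis
      proof cases
        case LL
        then have mem: "i \<in> Q" "j \<in> Q" "m \<in> Q" "i' \<in> Q" "j' \<in> Q" "m' \<in> Q"
          using s s' by (auto simp: I_def)
        have "U s \<inter> U s' \<noteq> {} \<longleftrightarrow> i = i' \<and> (\<exists>x\<in>Q. f j m x = f j' m' x)"
          unfolding LL U_def by auto
        also have "\<dots> \<longleftrightarrow> i = i' \<and> (j \<noteq> j' \<or> m = m')" using f mem by simp
        finally have 1: "U s \<inter> U s' \<noteq> {} \<longleftrightarrow> i = i' \<and> (j \<noteq> j' \<or> m = m')" .
        have "V s \<inter> V s' \<noteq> {} \<longleftrightarrow> (\<exists>x\<in>Q. f i j x = f i' j' x)"
          unfolding LL V_def by auto
        also have "\<dots> \<longleftrightarrow> i \<noteq> i' \<or> j = j'" using f mem by simp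
        finally show ?thesis using 1 ne LL by auto
      next
        case LR
        then have "V s \<inter> V s' \<noteq> {}" using VE[of i j m] s by (auto simp: V_def I_def)
        moreover have "U s \<inter> U s' = {}" unfolding LR U_def by auto
        ultimately show ?thesis by simp
      next
        case RL
        then have "V s \<inter> V s' \<noteq> {}" using VE[of i j m] s' by (auto simp: V_def I_def)
        moreover have "U s \<inter> U s' = {}" unfolding RL U_def by auto
        ultimately show ?thesis by simp
      next
        case RR
        then have "U s \<inter> U s' = {}" "V s \<inter> V s' \<noteq> {}" using ne o' by (auto simp: U_def V_def)
        then show ?thesis by simp
      qed
    qed
  qed
  ultimately show ?thesis by simp
qed

theorem theorem3p9:
  fixes p N :: nat and A B :: "'a set"
  assumes "finite A" and "finite B" and "A \<inter> B = {}" and "card A = N" and "card B = N"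
    and "primepow p"
    and "N \<ge> p ^ 3"
  shows "int (max_semiintersecting p A B) \<ge> \<lfloor>real N / real p\<rfloor> - int p ^ 2 + int p ^ 3"
proof -
  have p0: "p > 0" using assms(6) by (simp add: primepow_gt_0_nat)
  have "p ^ 2 * p \<le> N" using assms(7) by (simp add: power2_eq_square power3_eq_cube)
  then have D: "p ^ 2 \<le> N div p" using p0 by (simp add: less_eq_div_iff_mult_less_eq)
  have "p ^ 2 \<le> p ^ 3" using p0 by (simp add: power_increasing)
  then have "p ^ 3 + (N div p - p ^ 2) \<le> max_semiintersecting p A B"
    using assms D by (intro max_semiintersecting_ge_primepow) auto
  then have "int (p ^ 3 + (N div p - p ^ 2)) \<le> int (max_semiintersecting p A B)"
    by (simp only: of_nat_le_iff)
  moreover have "\<lfloor>real N / real p\<rfloor> = int (N div p)" by (rule floor_divide_of_nat_eq)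
  ultimately show ?thesis using D by (simp add: of_nat_diff)
qed

end
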